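(* Let $n\ge 2$ and let $C: My^2 = a_0 x^n + a_1 x^{n-1} + \cdots + a_{n-1}x + a_n$ be a nonsingular algebraic curve of genus $g\ge 0$ and degree $n=\deg C\ge 2$, with coefficients $a_0,a_1,\dots,a_n\in\mathbb{Z}$. Let $M,\alpha\ge 1$ be odd integers all of whose prime divisors are congruent to $1$ modulo $4$. Suppose that there are integers $k\ge 0$ and $U\ge 0$ such that $$\sum_{j=0}^{n}(-1)^{n-j+1}a_j = M\alpha^2,\qquad \sum_{j=0}^{n-1}(-1)^{n-j+1}a_j = 4k-1,$$ $$\sum_{j=0}^{n-3}(-1)^{n-j-2}a_j(n-j)(n-j-2)+a_{n-1} = 4U-1.$$ If $x>1$ and $y\ge 1$ hold for all $(x,y)\in C(\mathbb{Z}^+)$, then $C(\mathbb{Z}^+)=\emptyset$.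
   Context: $C(\mathbb{Z}^+)$ denotes the set of pairs $(x,y)$ of positive integers satisfying the equation of $C$. Empty sums are $0$. The condition on prime divisors is vacuous for the integer $1$. *)

theory Defs
  imports "HOL-Computational_Algebra.Computational_Algebra" "HOL-Number_Theory.Cong"
begin

text \<open>A plane curve is given by a bivariate polynomial, written as a polynomial in \<open>Y\<close>
  whose coefficients are polynomials in \<open>X\<close>.\<close>

definition eval2 :: "'a::comm_ring_1 poly poly \<Rightarrow> 'a \<Rightarrow> 'a \<Rightarrow> 'a" where
  "eval2 P x y = poly (poly P [:y:]) x"

definition total_degree :: "'a::zero poly poly \<Rightarrow> nat" where
  "total_degree P = Max {i + degree (coeff P i) | i. coeff P i \<noteq> 0}"

definition complexify :: "int poly poly \<Rightarrow> complex poly poly" where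
  "complexify = map_poly (map_poly of_int)"

text \<open>Jacobian criterion at every affine point over the complex numbers; here \<open>map_poly pderiv\<close>
  is the partial derivative in \<open>X\<close> and \<open>pderiv\<close> the one in \<open>Y\<close>. Only affine
  points are considered: the projective closure in \<open>P\<^sup>2\<close> of a curve \<open>M Y\<^sup>2 = f(X)\<close> with
  \<open>deg f \<ge> 4\<close> is always singular at infinity.\<close>

definition nonsingular_curve :: "int poly poly \<Rightarrow> bool" where
  "nonsingular_curve P \<longleftrightarrow>
    (\<forall>x y. eval2 (complexify P) x y = 0 \<longrightarrow>
      eval2 (map_poly pderiv (complexify P)) x y \<noteq> 0 \<or>
      eval2 (pderiv (complexify P)) x y \<noteq> 0)"

definition positive_points :: "int poly poly \<Rightarrow> (int \<times> int) set" where
  "positive_points P = {(x, y). x > 0 \<and> y > 0 \<and> eval2 P x y = 0}"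

definition curve :: "int \<Rightarrow> nat \<Rightarrow> (nat \<Rightarrow> int) \<Rightarrow> int poly poly" where
  "curve M n a = monom [:M:] 2 - [:\<Sum>j=0..n. monom (a j) (n - j):]"

lemma positive_points_curve:
  "positive_points (curve M n a) =
    {(x, y). x > 0 \<and> y > 0 \<and> M * y^2 = (\<Sum>j=0..n. a j * x^(n - j))}"
  by (simp add: positive_points_def eval2_def curve_def poly_monom poly_sum poly_power)

lemma total_degree_curve:
  assumes "n \<ge> 2" "a 0 \<noteq> 0" "M \<noteq> 0"
  shows "total_degree (curve M n a) = n"
proof -
  let ?f = "\<Sum>j=0..n. monom (a j) (n - j)"
  have cn: "coeff ?f n = a 0"
  proof -
    have "coeff ?f n = (\<Sum>j=0..n. if j = 0 then a j else 0)"
      unfolding coeff_sum coeff_monom using assms(1) by (intro sum.cong) auto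
    then show ?thesis by simp
  qed
  have "degree ?f \<le> n"
    by (rule degree_sum_le) (auto intro: order_trans[OF degree_monom_le])
  moreover have "n \<le> degree ?f" using cn assms by (intro le_degree) simp
  ultimately have d: "degree ?f = n" by simp
  have f0: "?f \<noteq> 0" using cn assms by auto
  have c: "coeff (curve M n a) i = (if i = 0 then - ?f else if i = 2 then [:M:] else 0)" for i
    by (auto simp: curve_def coeff_pCons split: nat.splits)
  have "{i + degree (coeff (curve M n a) i) | i. coeff (curve M n a) i \<noteq> 0} = {n, 2}"
  proof (intro equalityI subsetI)
    fix d' assume "d' \<in> {i + degree (coeff (curve M n a) i) | i. coeff (curve M n a) i \<noteq> 0}"
    then show "d' \<in> {n, 2}" unfolding c using d by (auto split: if_splits)
  next
    fix d' assume "d' \<in> {n, 2}"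
    moreover have "n = 0 + degree (coeff (curve M n a) 0)" "coeff (curve M n a) 0 \<noteq> 0"
      "2 = 2 + degree (coeff (curve M n a) 2)" "coeff (curve M n a) 2 \<noteq> 0"
      unfolding c using d f0 assms by simp_all
    ultimately show "d' \<in> {i + degree (coeff (curve M n a) i) | i. coeff (curve M n a) i \<noteq> 0}"
      by blast
  qed
  then show ?thesis using assms by (simp add: total_degree_def max_def)
qed

lemma nonsingular_curve_iff:
  fixes M :: int and n :: nat and a :: "nat \<Rightarrow> int"
  assumes "M \<noteq> 0"
  defines "f \<equiv> map_poly complex_of_int (\<Sum>j=0..n. monom (a j) (n - j))"
  shows "nonsingular_curve (curve M n a) \<longleftrightarrow> (\<forall>x. poly f x = 0 \<longrightarrow> poly (pderiv f) x \<noteq> 0)"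
proof -
  have of_int_minus: "map_poly complex_of_int (- p) = - map_poly complex_of_int p" for p
    by (intro poly_eqI) (simp add: coeff_map_poly)
  have C: "complexify (curve M n a) = monom [:of_int M:] 2 - [:f:]"
    by (intro poly_eqI)
      (auto simp: complexify_def curve_def f_def coeff_map_poly coeff_pCons of_int_minus
        map_poly_pCons split: nat.splits)
  have X: "map_poly pderiv (monom [:of_int M:] 2 - [:f:]) = - [:pderiv f:]"
    by (intro poly_eqI) (auto simp: coeff_map_poly coeff_pCons pderiv_minus pderiv_pCons
        split: nat.splits)
  have "nonsingular_curve (curve M n a) \<longleftrightarrow>
      (\<forall>x y. of_int M * y^2 = poly f x \<longrightarrow> poly (pderiv f) x = 0 \<longrightarrow> y \<noteq> 0)"
    unfolding nonsingular_curve_def C X using assms(1)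
    by (auto simp: eval2_def poly_monom poly_power pderiv_diff pderiv_monom pderiv_pCons)
  also have "\<dots> \<longleftrightarrow> (\<forall>x. poly f x = 0 \<longrightarrow> poly (pderiv f) x \<noteq> 0)"
  proof (intro iffI allI impI)
    fix x
    assume *: "\<forall>x y. of_int M * y^2 = poly f x \<longrightarrow> poly (pderiv f) x = 0 \<longrightarrow> y \<noteq> 0"
      and "poly f x = 0"
    then show "poly (pderiv f) x \<noteq> 0" using *[THEN spec[of _ x], THEN spec[of _ 0]] by simp
  next
    fix x y
    assume "\<forall>x. poly f x = 0 \<longrightarrow> poly (pderiv f) x \<noteq> 0"
      and "of_int M * y^2 = poly f x" and "poly (pderiv f) x = 0"
    then show "y \<noteq> 0" by (cases "y = 0") auto
  qed
  finally show ?thesis .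
qed

end

theory Submission
  imports "HOL-Number_Theory.Residues" Defs
begin

text \<open>
  Write \<open>f\<close> for the polynomial on the right-hand side of \<open>C\<close>. The first condition on the \<open>a\<^sub>j\<close> says
  \<open>f(-1) = - M \<alpha>\<^sup>2\<close>, so \<open>f + M \<alpha>\<^sup>2 = (X + 1) g\<close> for an integer polynomial \<open>g\<close>, and an
  integral point of \<open>C\<close> satisfies
    \<open>M (y\<^sup>2 + \<alpha>\<^sup>2) = (x + 1) g(x)\<close>.
  The left-hand side is severely restricted. A prime \<open>p\<close> congruent to 3 modulo 4 that divides
  \<open>y\<^sup>2 + \<alpha>\<^sup>2\<close> divides \<open>\<alpha>\<close>, because -1 is not a square modulo \<open>p\<close>; but all prime
  divisors of \<open>M\<close> and \<open>\<alpha>\<close> are congruent to 1. Hence no such prime divides the left-hand side,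
  and all its positive odd divisors are congruent to 1 modulo 4
  (\<open>odd_dvd_times_sum_squares_cong_1\<close>). It is not divisible by 4 either, because \<open>M\<close> and
  \<open>\<alpha>\<close> are odd.

  The right-hand side violates this in every residue class of \<open>x\<close> modulo 4. For
  \<open>x \<equiv> 2\<close> the factor \<open>x + 1\<close> is congruent to 3, and for \<open>x \<equiv> 3\<close> it is divisible by 4. In the
  other two classes the factor \<open>g(x)\<close> is congruent to 3: the first two conditions
  give \<open>g(0) = 4 k - 1\<close>, and the third one says \<open>f'(-1) + f''(-1) = 4 U - 1\<close>, where
  \<open>f'(-1) + f''(-1) = g(-1) + 2 g'(-1)\<close> is congruent to \<open>g(1)\<close> modulo 4 by a Taylor expansion
  at -1 (\<open>poly_add_cong_pderiv\<close>).
\<close>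

section \<open>Odd divisors of sums of two squares\<close>

text \<open>Since \<open>(p - 1) / 2\<close> is odd, raising \<open>y\<^sup>2 \<equiv> - z\<^sup>2\<close> to this power gives
  \<open>y\<^bsup>p-1\<^esup> \<equiv> - z\<^bsup>p-1\<^esup>\<close>, which Fermat's theorem turns into \<open>1 \<equiv> -1\<close> unless \<open>p\<close> divides
  \<open>z\<close>.\<close>

lemma prime_cong_3_dvd_sum_squares:
  fixes p y z :: int
  assumes p: "prime p" "p mod 4 = 3" and dvd: "p dvd y^2 + z^2"
  shows "p dvd z"
proof (rule ccontr)
  assume nz: "\<not> p dvd z"
  have ny: "\<not> p dvd y"
  proof
    assume "p dvd y"
    then have "p dvd y^2" by (simp add: power2_eq_square)
    then have "p dvd z^2" using dvd by (simp add: dvd_add_right_iff)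
    then show False using nz p(1) prime_dvd_power by blast
  qed
  have p3: "p \<ge> 3" using p prime_gt_0_int[of p] by presburger
  define m where "m = nat (p div 4)"
  have "p = int (4 * m + 3)" using p(2) p3 mult_div_mod_eq[of 4 p] by (simp add: m_def)
  then have pm: "nat p - 1 = 2 * (2 * m + 1)" by simp
  have fermat: "[w ^ (2 * (2 * m + 1)) = 1] (mod p)" if nw: "\<not> p dvd w" for w :: int
  proof -
    have "[nat \<bar>w\<bar> ^ (nat p - 1) = 1] (mod nat p)"
      using p(1) nw p3 by (intro fermat_theorem) (auto simp: nat_dvd_iff)
    then have "[int (nat \<bar>w\<bar> ^ (nat p - 1)) = int 1] (mod int (nat p))"
      by (simp only: cong_int_iff)
    then show ?thesis
      using p3 unfolding pm power_mult[of _ 2 "2 * m + 1"] by (simp del: power_Suc)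
  qed
  have "[y^2 = - (z^2)] (mod p)" using dvd by (simp add: cong_iff_dvd_diff)
  then have "[(y^2) ^ (2 * m + 1) = (- (z^2)) ^ (2 * m + 1)] (mod p)" by (rule cong_pow)
  then have "[y ^ (2 * (2 * m + 1)) = - (z ^ (2 * (2 * m + 1)))] (mod p)"
    unfolding power_mult[of _ 2 "2 * m + 1"] by simp
  then have "[1 = - (1::int)] (mod p)"
    using fermat[OF ny] fermat[OF nz]
    by (meson cong_minus_minus_iff cong_sym cong_trans)
  then have "p dvd 2" by (simp add: cong_iff_dvd_diff)
  then show False using p3 zdvd_imp_le by fastforce
qed

lemma cong_1_mod_4_if_prime_divisors:
  fixes d :: int
  assumes "d > 0" and "\<And>p. prime p \<Longrightarrow> p dvd d \<Longrightarrow> [p = 1] (mod 4)"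
  shows "[d = 1] (mod 4)"
  using assms
proof (induction d rule: prime_divisors_induct)
  case (unit d)
  then show ?case by (simp add: zdvd1_eq)
next
  case (factor p d)
  have "d > 0" using factor.prems(1) prime_gt_0_int[OF factor.hyps(1)]
    by (simp add: zero_less_mult_iff)
  then have "[d = 1] (mod 4)" using factor by auto
  moreover have "[p = 1] (mod 4)" using factor by auto
  ultimately show ?case using cong_mult by fastforce
qed simp

lemma odd_dvd_times_sum_squares_cong_1:
  fixes d M y z :: int
  assumes d: "d > 0" "odd d" "d dvd M * (y^2 + z^2)"
    and M: "\<And>p. prime p \<Longrightarrow> p dvd M \<Longrightarrow> [p = 1] (mod 4)"
    and z: "\<And>p. prime p \<Longrightarrow> p dvd z \<Longrightarrow> [p = 1] (mod 4)"
  shows "[d = 1] (mod 4)"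
proof (rule cong_1_mod_4_if_prime_divisors[OF d(1)])
  fix p :: int
  assume p: "prime p" "p dvd d"
  then have "odd p" using d(2) dvd_trans by blast
  have "p dvd M \<or> p dvd y^2 + z^2"
    using p d(3) dvd_trans prime_dvd_mult_iff by blast
  then show "[p = 1] (mod 4)"
  proof
    assume dvd: "p dvd y^2 + z^2"
    show ?thesis
    proof (rule ccontr)
      assume "\<not> [p = 1] (mod 4)"
      then have "p mod 4 = 3" using \<open>odd p\<close> unfolding cong_def by presburger
      then show False
        using prime_cong_3_dvd_sum_squares[OF p(1) _ dvd] z[OF p(1)] by (simp add: cong_def)
    qed
  qed (use M p in blast)
qed

lemma not_4_dvd_odd_times_sum_squares:
  fixes M y z :: int
  assumes "odd M" "odd z"
  shows "\<not> 4 dvd M * (y^2 + z^2)"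
proof
  assume "4 dvd M * (y^2 + z^2)"
  moreover have "coprime (4::int) M"
    using assms(1) coprime_power_left_iff[of 2 2 M] by simp
  ultimately have 4: "4 dvd y^2 + z^2" by (simp add: coprime_dvd_mult_right_iff)
  then have "even (y^2 + z^2)" by (rule dvd_trans[rotated]) simp
  then have "odd y" using assms(2) by simp
  then obtain u v where "y = 2 * u + 1" "z = 2 * v + 1"
    using assms(2) by (auto elim!: oddE)
  then have "y^2 + z^2 = 4 * (u^2 + u + v^2 + v) + 2"
    by (simp add: power2_eq_square algebra_simps)
  then show False using 4 by presburger
qed

section \<open>Values of integer polynomials\<close>

lemma poly_add_cong_pderiv:
  fixes p :: "int poly"
  shows "[poly p (x + h) = poly p x + h * poly (pderiv p) x] (mod h^2)"
proof (induction p)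
  case (pCons c p)
  have "[c + (x + h) * poly p (x + h)
      = c + (x + h) * (poly p x + h * poly (pderiv p) x)] (mod h^2)"
    by (intro cong_add cong_mult cong_refl pCons.IH)
  also have "[c + (x + h) * (poly p x + h * poly (pderiv p) x)
      = poly (pCons c p) x + h * poly (pderiv (pCons c p)) x] (mod h^2)"
    by (simp add: cong_iff_dvd_diff pderiv_pCons algebra_simps power2_eq_square)
  finally show ?case by simp
qed simp

lemma poly_cong:
  fixes p :: "int poly"
  assumes "[x = y] (mod m)"
  shows "[poly p x = poly p y] (mod m)"
  by (induction p) (auto intro!: cong_add cong_mult assms)

text \<open>The weights \<open>m (m - 2) = m (m - 1) - m\<close> combine the first two derivatives of \<open>X\<^sup>m\<close> at
  -1, and the factor \<open>m - 2\<close> is what lets the term \<open>m = 2\<close> be omitted from the sum.\<close>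

lemma pderiv_plus_pderiv2_at_minus_1:
  fixes a :: "nat \<Rightarrow> int"
  assumes "n \<ge> 2"
  defines "f \<equiv> (\<Sum>j=0..n. monom (a j) (n - j))"
  shows "poly (pderiv f) (-1) + poly (pderiv (pderiv f)) (-1)
    = (\<Sum>j=0..<n-2. (-1)^(n - j - 2) * a j * (int n - int j) * (int n - int j - 2)) + a (n - 1)"
proof -
  have monom: "poly (pderiv (monom c m)) (-1) + poly (pderiv (pderiv (monom c m))) (-1)
      = (-1)^m * c * int m * (int m - 2)" for c :: int and m
    by (cases m; cases "m - 1") (auto simp: pderiv_monom poly_monom algebra_simps)
  have distinct: "n - 2 \<noteq> n - 1" "n - 2 \<noteq> n" "n - 1 \<noteq> n"
    and diff: "n - (n - 2) = 2" "n - (n - 1) = 1" using assms(1) by auto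
  have "pderiv f = (\<Sum>j=0..n. pderiv (monom (a j) (n - j)))"
    "pderiv (pderiv f) = (\<Sum>j=0..n. pderiv (pderiv (monom (a j) (n - j))))"
    using higher_pderiv_sum[of 1 _ "{0..n}"] higher_pderiv_sum[of 2 _ "{0..n}"]
    by (simp_all add: f_def numeral_2_eq_2)
  then have "poly (pderiv f) (-1) + poly (pderiv (pderiv f)) (-1)
      = (\<Sum>j=0..n. (-1)^(n - j) * a j * int (n - j) * (int (n - j) - 2))"
    by (simp only: poly_sum monom flip: sum.distrib)
  also have "{0..n} = {0..<n-2} \<union> {n - 2, n - 1, n}" using assms(1) by auto
  also have "(\<Sum>j\<in>\<dots>. (-1)^(n - j) * a j * int (n - j) * (int (n - j) - 2))
      = (\<Sum>j=0..<n-2. (-1)^(n - j) * a j * int (n - j) * (int (n - j) - 2)) + a (n - 1)"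
    using distinct by (subst sum.union_disjoint) (auto simp: diff)
  also have "(\<Sum>j=0..<n-2. (-1)^(n - j) * a j * int (n - j) * (int (n - j) - 2))
      = (\<Sum>j=0..<n-2. (-1)^(n - j - 2) * a j * (int n - int j) * (int n - int j - 2))"
  proof (rule sum.cong[OF refl])
    fix j assume "j \<in> {0..<n-2}"
    then have "n - j = Suc (Suc (n - j - 2))" and j: "int (n - j) = int n - int j" by auto
    then have "(-1::int) ^ (n - j) = (-1) ^ (n - j - 2)"
      by (metis power_Suc mult_minus1 minus_minus)
    then show "(-1)^(n - j) * a j * int (n - j) * (int (n - j) - 2)
        = (-1)^(n - j - 2) * a j * (int n - int j) * (int n - int j - 2)" by (simp only: j)
  qed
  finally show ?thesis .
qed

section \<open>Absence of positive integral points\<close>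

theorem theorem3p2:
  fixes n :: nat and a :: "nat \<Rightarrow> int" and M \<alpha> k U :: int
  assumes "n \<ge> 2"
    and "nonsingular_curve (curve M n a)"
    and "total_degree (curve M n a) = n"
    and "M \<ge> 1" and "odd M" and "\<And>p. prime p \<Longrightarrow> p dvd M \<Longrightarrow> [p = 1] (mod 4)"
    and "\<alpha> \<ge> 1" and "odd \<alpha>" and "\<And>p. prime p \<Longrightarrow> p dvd \<alpha> \<Longrightarrow> [p = 1] (mod 4)"
    and "k \<ge> 0" and "U \<ge> 0"
    and "(\<Sum>j=0..n. (-1)^(n - j + 1) * a j) = M * \<alpha>^2"
    and "(\<Sum>j=0..n-1. (-1)^(n - j + 1) * a j) = 4 * k - 1"
    and "(\<Sum>j=0..<n-2. (-1)^(n - j - 2) * a j * (int n - int j) * (int n - int j - 2)) + a (n - 1)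
         = 4 * U - 1"
    and "\<forall>(x, y) \<in> positive_points (curve M n a). x > 1 \<and> y \<ge> 1"
  shows "positive_points (curve M n a) = {}"
proof (rule ccontr)
  assume "positive_points (curve M n a) \<noteq> {}"
  then obtain x y where xy: "x > 0" "y > 0" "M * y^2 = (\<Sum>j=0..n. a j * x^(n - j))"
    unfolding positive_points_curve by auto
  define f where "f = (\<Sum>j=0..n. monom (a j) (n - j))"
  have poly_f: "poly f t = (\<Sum>j=0..n. a j * t^(n - j))" for t
    by (simp add: f_def poly_sum poly_monom)

  have "poly f (-1) = - (M * \<alpha>^2)"
    using assms(12) by (simp add: poly_f sum_negf mult.commute)
  then have "poly (f + [:M * \<alpha>^2:]) (-1) = 0" by simp
  then have "[:1, 1:] dvd f + [:M * \<alpha>^2:]" by (simp add: poly_eq_0_iff_dvd del: poly_add)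
  then obtain g where g: "f + [:M * \<alpha>^2:] = [:1, 1:] * g" by (auto elim: dvdE)
  have f_g: "poly f t + M * \<alpha>^2 = (1 + t) * poly g t" for t
    using arg_cong[OF g, of "\<lambda>p. poly p t"] by (simp add: algebra_simps)

  have "poly f 0 = a n"
  proof -
    have "poly f 0 = (\<Sum>j\<in>{0..n}. if j = n then a j else 0)"
      unfolding poly_f by (intro sum.cong) (auto simp: power_0_left)
    then show ?thesis by simp
  qed
  moreover have "M * \<alpha>^2 = 4 * k - 1 - a n"
  proof -
    obtain m where "n = Suc m" using assms(1) by (cases n) auto
    then show ?thesis using assms(12,13) by (simp add: sum.atLeast0_atMost_Suc)
  qed
  ultimately have g0: "poly g 0 = 4 * k - 1" using f_g[of 0] by simp

  have f': "pderiv f = g + [:1, 1:] * pderiv g"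
    using arg_cong[OF g, of pderiv] by (simp add: pderiv_add pderiv_mult pderiv_pCons)
  then have "pderiv (pderiv f) = pderiv g + pderiv g + [:1, 1:] * pderiv (pderiv g)"
    by (simp add: pderiv_add pderiv_mult pderiv_pCons)
  with f' have "poly g (-1) + 2 * poly (pderiv g) (-1) = 4 * U - 1"
    using pderiv_plus_pderiv2_at_minus_1[OF assms(1), of a] assms(14) by (simp add: f_def)
  then have g1: "[poly g 1 = 4 * U - 1] (mod 4)"
    using poly_add_cong_pderiv[of g "-1" 2] by simp

  have point: "M * (y^2 + \<alpha>^2) = (1 + x) * poly g x"
    using f_g[of x] xy(3) by (simp add: poly_f algebra_simps)
  have "M * (y^2 + \<alpha>^2) > 0" using assms(4) xy by (simp add: add_pos_nonneg)
  then have gx_pos: "poly g x > 0" using point xy(1) by (simp add: zero_less_mult_iff)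
  have odd_divisor: "d mod 4 \<noteq> 3" if "d > 0" "d dvd (1 + x) * poly g x" for d
  proof
    assume d: "d mod 4 = 3"
    then have "odd d" by presburger
    then have "[d = 1] (mod 4)"
      using odd_dvd_times_sum_squares_cong_1[of d M y \<alpha>] that assms(6,9) point by simp
    then show False using d by (simp add: cong_def)
  qed

  have "x mod 4 = 0 \<or> x mod 4 = 1 \<or> x mod 4 = 2 \<or> x mod 4 = 3" by presburger
  then consider "x mod 4 = 0" | "x mod 4 = 1" | "x mod 4 = 2" | "x mod 4 = 3" by blast
  then show False
  proof cases
    case 1
    then have "[poly g x = poly g 0] (mod 4)" by (intro poly_cong) (simp add: cong_def)
    then have "poly g x mod 4 = 3" unfolding g0 cong_def by presburger
    then show False using odd_divisor[OF gx_pos] by simp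
  next
    case 2
    then have "[poly g x = poly g 1] (mod 4)" by (intro poly_cong) (simp add: cong_def)
    then have "poly g x mod 4 = 3" using g1 unfolding cong_def by presburger
    then show False using odd_divisor[OF gx_pos] by simp
  next
    case 3
    then have "(1 + x) mod 4 = 3" by presburger
    then show False using odd_divisor[of "1 + x"] xy(1) by simp
  next
    case 4
    then have "4 dvd 1 + x" by presburger
    then have "4 dvd M * (y^2 + \<alpha>^2)" unfolding point by (rule dvd_mult2)
    then show False using not_4_dvd_odd_times_sum_squares assms(5,8) by blast
  qed
qed

end
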